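(* Let $G$ be a negative definite, unimodular, almost rational plumbing graph with distinguished vertex $v_0$, let $(k(i))_{i\ge0}$ be its Laufer sequence and $R$ its graded root. Then any terminal cohomology class $\ell$ of a good full path appears in the Laufer sequence, i.e. $\ell=k(i)$ for some $i$, and it corresponds to a leaf of the graded root $R$.
   Context: $G$ is a weighted tree with vertices $v_j$ ($j\in\mathcal J$) and integer weights $e_j$; $\mathcal L=\mathbb Z\langle v_j\rangle$ carries the intersection form $I$ ($v_j\cdot v_j=e_j$; $v_i\cdot v_j=1$ if adjacent, $0$ otherwise), assumed negative definite and unimodular. $\mathrm{PD}:\mathcal L\to\mathcal L'=\mathrm{Hom}(\mathcal L,\mathbb Z)$ is $x\mapsto x^tI(\cdot)$. $\mathrm{Char}(G)$ is the set of $k\in\mathcal L'$ with $\langle k,v_j\rangle\equiv e_j \pmod 2$ for all $j$; the canonical class has $\langle k_{\mathrm{can}},v_j\rangle=-e_j-2$. For $k\in\mathrm{Char}(G)$ let $\chi_k(x)=-(\langle k,x\rangle+x\cdot x)/2$, so $\chi_k(v_j)=-(\langle k,v_j\rangle+e_j)/2$. $G$ is rational if $\chi_{k_{\mathrm{can}}}(x)\ge1$ for all $x>0$ (nonzero with non-negative coefficients), and almost rational if it becomes rational after decreasing the weight of some vertex $v_0$; this $v_0$ is fixed. Full paths (Ozsváth–Szabó): start with an initial $k\in\mathrm{Char}(G)$ with $e_j+2\le\langle k,v_j\rangle\le -e_j$ for all $j$. Given $k_m$, if some vertex $v_j$ has $\langle k_m,v_j\rangle=-e_j$, set $k_{m+1}=k_m+2\mathrm{PD}(v_j)$.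 The process stops at a terminal class $\ell$ when either some $\langle\ell,v_j\rangle>-e_j$, or $e_j\le\langle\ell,v_j\rangle\le-e_j-2$ for all $j$. In the latter case the full path is called good. Laufer sequence: $k(0)=k_{\mathrm{can}}$; given $k(i)$, put $x_0=k(i)+2\mathrm{PD}(v_0)$ and, while there is $j\ne0$ with $\langle x_m,v_j\rangle=-e_j$, put $x_{m+1}=x_m+2\mathrm{PD}(v_j)$; when no such $j$ exists, set $k(i+1)=x_m$. Graded root: let $\tau(0)=0$, $\tau(i)=\sum_{s=0}^{i-1}\chi_{k(s)}(v_0)$. Let $R_i$ be the half-infinite path graph with vertex set $\mathbb Z\cap[\tau(i),\infty)$ and edges between consecutive integers; $R$ is obtained from $\bigsqcup_i R_i$ by identifying, for each $i$, the common vertices and edges of $R_i$ and $R_{i+1}$. A leaf is a vertex of valency $1$. The class $k(i)$ corresponds to the vertex of $R$ represented by $\tau(i)\in R_i$. *)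

theory Defs
  imports "HOL-Analysis.Analysis" "HOL-Number_Theory.Cong"
begin

text \<open>
  A weighted graph is given by an adjacency relation \<open>adj\<close> on a finite type \<open>'v\<close> of
  vertices together with a weight function \<open>e\<close>. The lattice \<open>L\<close> freely generated by the
  vertices is \<open>int ^ 'v\<close>, where the vertex \<open>v\<close> is the basis vector \<open>axis v 1\<close>; its dual
  \<open>L'\<close> is the set of additive functions from \<open>int ^ 'v\<close> to \<open>int\<close>.
\<close>

section \<open>Plumbing trees and their lattices\<close>

definition simple_graph :: "('v \<Rightarrow> 'v \<Rightarrow> bool) \<Rightarrow> bool" where
  "simple_graph adj \<longleftrightarrow> (\<forall>u. \<not> adj u u) \<and> (\<forall>u v. adj u v \<longrightarrow> adj v u)"

definition is_cycle :: "('v \<Rightarrow> 'v \<Rightarrow> bool) \<Rightarrow> 'v list \<Rightarrow> bool" where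
  "is_cycle adj vs \<longleftrightarrow>
     3 \<le> length vs \<and> distinct vs \<and> successively adj vs \<and> adj (last vs) (hd vs)"

definition is_tree :: "('v \<Rightarrow> 'v \<Rightarrow> bool) \<Rightarrow> bool" where
  "is_tree adj \<longleftrightarrow>
     simple_graph adj \<and> (\<forall>u v. adj\<^sup>*\<^sup>* u v) \<and> (\<nexists>vs. is_cycle adj vs)"

abbreviation vtx :: "'v::finite \<Rightarrow> int ^ 'v" where
  "vtx v \<equiv> axis v 1"

definition int_matrix :: "('v::finite \<Rightarrow> 'v \<Rightarrow> bool) \<Rightarrow> ('v \<Rightarrow> int) \<Rightarrow> int ^ 'v ^ 'v" where
  "int_matrix adj e = (\<chi> i j. if i = j then e i else if adj i j then 1 else 0)"

definition int_form ::
  "('v::finite \<Rightarrow> 'v \<Rightarrow> bool) \<Rightarrow> ('v \<Rightarrow> int) \<Rightarrow> int ^ 'v \<Rightarrow> int ^ 'v \<Rightarrow> int" where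
  "int_form adj e x y = (\<Sum>i\<in>UNIV. \<Sum>j\<in>UNIV. x $ i * int_matrix adj e $ i $ j * y $ j)"

definition negative_definite :: "('v::finite \<Rightarrow> 'v \<Rightarrow> bool) \<Rightarrow> ('v \<Rightarrow> int) \<Rightarrow> bool" where
  "negative_definite adj e \<longleftrightarrow> (\<forall>x. x \<noteq> 0 \<longrightarrow> int_form adj e x x < 0)"

definition dual_lattice :: "(int ^ 'v::finite \<Rightarrow> int) set" where
  "dual_lattice = {k. Modules.additive k}"

definition PD ::
  "('v::finite \<Rightarrow> 'v \<Rightarrow> bool) \<Rightarrow> ('v \<Rightarrow> int) \<Rightarrow> int ^ 'v \<Rightarrow> (int ^ 'v \<Rightarrow> int)" where
  "PD adj e x = (\<lambda>y. int_form adj e x y)"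

definition unimodular :: "('v::finite \<Rightarrow> 'v \<Rightarrow> bool) \<Rightarrow> ('v \<Rightarrow> int) \<Rightarrow> bool" where
  "unimodular adj e \<longleftrightarrow> bij_betw (PD adj e) UNIV dual_lattice"

definition Char_classes :: "('v::finite \<Rightarrow> int) \<Rightarrow> (int ^ 'v \<Rightarrow> int) set" where
  "Char_classes e = {k \<in> dual_lattice. \<forall>j. [k (vtx j) = e j] (mod 2)}"

definition k_can :: "('v::finite \<Rightarrow> int) \<Rightarrow> (int ^ 'v \<Rightarrow> int)" where
  "k_can e = (\<lambda>x. \<Sum>j\<in>UNIV. x $ j * (- e j - 2))"

text \<open>
  The integer division below is exact for characteristic \<open>k\<close>, since then
  \<open>k x + x \<cdot> x\<close> is even for every \<open>x\<close>.
\<close>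
definition chi_fun ::
  "('v::finite \<Rightarrow> 'v \<Rightarrow> bool) \<Rightarrow> ('v \<Rightarrow> int) \<Rightarrow> (int ^ 'v \<Rightarrow> int) \<Rightarrow> int ^ 'v \<Rightarrow> int" where
  "chi_fun adj e k x = (- (k x + int_form adj e x x)) div 2"

definition rational_graph :: "('v::finite \<Rightarrow> 'v \<Rightarrow> bool) \<Rightarrow> ('v \<Rightarrow> int) \<Rightarrow> bool" where
  "rational_graph adj e \<longleftrightarrow>
     (\<forall>x. x \<noteq> 0 \<and> (\<forall>j. 0 \<le> x $ j) \<longrightarrow> 1 \<le> chi_fun adj e (k_can e) x)"

definition almost_rational_at ::
  "('v::finite \<Rightarrow> 'v \<Rightarrow> bool) \<Rightarrow> ('v \<Rightarrow> int) \<Rightarrow> 'v \<Rightarrow> bool" where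
  "almost_rational_at adj e v0 \<longleftrightarrow> (\<exists>n < e v0. rational_graph adj (e(v0 := n)))"

definition add_2PD ::
  "('v::finite \<Rightarrow> 'v \<Rightarrow> bool) \<Rightarrow> ('v \<Rightarrow> int) \<Rightarrow> 'v \<Rightarrow> (int ^ 'v \<Rightarrow> int) \<Rightarrow> (int ^ 'v \<Rightarrow> int)" where
  "add_2PD adj e v k = (\<lambda>y. k y + 2 * PD adj e (vtx v) y)"

section \<open>Full paths\<close>

definition initial_class :: "('v::finite \<Rightarrow> int) \<Rightarrow> (int ^ 'v \<Rightarrow> int) \<Rightarrow> bool" where
  "initial_class e k \<longleftrightarrow>
     k \<in> Char_classes e \<and> (\<forall>j. e j + 2 \<le> k (vtx j) \<and> k (vtx j) \<le> - e j)"

definition bad_terminal :: "('v::finite \<Rightarrow> int) \<Rightarrow> (int ^ 'v \<Rightarrow> int) \<Rightarrow> bool" where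
  "bad_terminal e k \<longleftrightarrow> (\<exists>j. k (vtx j) > - e j)"

definition good_terminal :: "('v::finite \<Rightarrow> int) \<Rightarrow> (int ^ 'v \<Rightarrow> int) \<Rightarrow> bool" where
  "good_terminal e k \<longleftrightarrow> (\<forall>j. e j \<le> k (vtx j) \<and> k (vtx j) \<le> - e j - 2)"

definition full_path_step ::
  "('v::finite \<Rightarrow> 'v \<Rightarrow> bool) \<Rightarrow> ('v \<Rightarrow> int) \<Rightarrow> (int ^ 'v \<Rightarrow> int) \<Rightarrow> (int ^ 'v \<Rightarrow> int) \<Rightarrow> bool" where
  "full_path_step adj e k k' \<longleftrightarrow>
     \<not> bad_terminal e k \<and> \<not> good_terminal e k \<and>
     (\<exists>j. k (vtx j) = - e j \<and> k' = add_2PD adj e j k)"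

definition full_path ::
  "('v::finite \<Rightarrow> 'v \<Rightarrow> bool) \<Rightarrow> ('v \<Rightarrow> int) \<Rightarrow> (int ^ 'v \<Rightarrow> int) list \<Rightarrow> bool" where
  "full_path adj e ks \<longleftrightarrow>
     ks \<noteq> [] \<and> initial_class e (hd ks) \<and> successively (full_path_step adj e) ks \<and>
     (bad_terminal e (last ks) \<or> good_terminal e (last ks))"

definition good_full_path ::
  "('v::finite \<Rightarrow> 'v \<Rightarrow> bool) \<Rightarrow> ('v \<Rightarrow> int) \<Rightarrow> (int ^ 'v \<Rightarrow> int) list \<Rightarrow> bool" where
  "good_full_path adj e ks \<longleftrightarrow> full_path adj e ks \<and> good_terminal e (last ks)"

section \<open>Laufer sequences\<close>

definition laufer_step ::
  "('v::finite \<Rightarrow> 'v \<Rightarrow> bool) \<Rightarrow> ('v \<Rightarrow> int) \<Rightarrow> 'v \<Rightarrow>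
   (int ^ 'v \<Rightarrow> int) \<Rightarrow> (int ^ 'v \<Rightarrow> int) \<Rightarrow> bool" where
  "laufer_step adj e v0 k k' \<longleftrightarrow>
     (\<exists>j. j \<noteq> v0 \<and> k (vtx j) = - e j \<and> k' = add_2PD adj e j k)"

text \<open>
  The procedure leaves open which vertex is used in each step, so being a Laufer sequence
  is a predicate that admits every possible run.
\<close>
definition laufer_sequence ::
  "('v::finite \<Rightarrow> 'v \<Rightarrow> bool) \<Rightarrow> ('v \<Rightarrow> int) \<Rightarrow> 'v \<Rightarrow> (nat \<Rightarrow> (int ^ 'v \<Rightarrow> int)) \<Rightarrow> bool" where
  "laufer_sequence adj e v0 k \<longleftrightarrow>
     k 0 = k_can e \<and>
     (\<forall>i. (laufer_step adj e v0)\<^sup>*\<^sup>* (add_2PD adj e v0 (k i)) (k (Suc i)) \<and>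
          (\<nexists>j. j \<noteq> v0 \<and> k (Suc i) (vtx j) = - e j))"

definition tau_fun ::
  "('v::finite \<Rightarrow> 'v \<Rightarrow> bool) \<Rightarrow> ('v \<Rightarrow> int) \<Rightarrow> 'v \<Rightarrow> (nat \<Rightarrow> (int ^ 'v \<Rightarrow> int)) \<Rightarrow> nat \<Rightarrow> int" where
  "tau_fun adj e v0 k i = (\<Sum>s<i. chi_fun adj e (k s) (vtx v0))"

section \<open>The graded root of a function on the natural numbers\<close>

text \<open>
  The pair \<open>(i, n)\<close> is the vertex \<open>n\<close> of the path \<open>R\<^sub>i\<close>; \<open>gr_glue\<close> identifies the common
  vertices of \<open>R\<^sub>i\<close> and \<open>R\<^sub>i\<^sub>+\<^sub>1\<close>, and the vertices of the graded root are the classes of the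
  generated equivalence relation. An edge is represented by the set of its two endpoints.
  This also performs the identification of common edges and creates no others: if two edges
  of \<open>R\<^sub>i\<close> and \<open>R\<^sub>j\<close> have the same endpoints in the quotient, then they are edges of every
  path between \<open>R\<^sub>i\<close> and \<open>R\<^sub>j\<close>.
\<close>
definition gr_points :: "(nat \<Rightarrow> int) \<Rightarrow> (nat \<times> int) set" where
  "gr_points \<tau> = {(i, n). \<tau> i \<le> n}"

definition gr_glue :: "(nat \<Rightarrow> int) \<Rightarrow> ((nat \<times> int) \<times> (nat \<times> int)) set" where
  "gr_glue \<tau> = {((i, n), (Suc i, n)) | i n. \<tau> i \<le> n \<and> \<tau> (Suc i) \<le> n}"

definition gr_rel :: "(nat \<Rightarrow> int) \<Rightarrow> ((nat \<times> int) \<times> (nat \<times> int)) set" where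
  "gr_rel \<tau> = (gr_glue \<tau> \<union> (gr_glue \<tau>)\<inverse>)\<^sup>*"

definition gr_class :: "(nat \<Rightarrow> int) \<Rightarrow> nat \<Rightarrow> int \<Rightarrow> (nat \<times> int) set" where
  "gr_class \<tau> i n = gr_rel \<tau> `` {(i, n)}"

definition gr_vertices :: "(nat \<Rightarrow> int) \<Rightarrow> (nat \<times> int) set set" where
  "gr_vertices \<tau> = gr_points \<tau> // gr_rel \<tau>"

definition gr_edges :: "(nat \<Rightarrow> int) \<Rightarrow> (nat \<times> int) set set set" where
  "gr_edges \<tau> = {{gr_class \<tau> i n, gr_class \<tau> i (n + 1)} | i n. \<tau> i \<le> n}"

definition gr_valency :: "(nat \<Rightarrow> int) \<Rightarrow> (nat \<times> int) set \<Rightarrow> nat" where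
  "gr_valency \<tau> u = card {d \<in> gr_edges \<tau>. u \<in> d}"

definition gr_leaf :: "(nat \<Rightarrow> int) \<Rightarrow> (nat \<times> int) set \<Rightarrow> bool" where
  "gr_leaf \<tau> u \<longleftrightarrow> u \<in> gr_vertices \<tau> \<and> gr_valency \<tau> u = 1"

end

theory Submission
  imports Defs
begin

text \<open>
  Write a characteristic class as \<open>k\<^sub>c\<^sub>a\<^sub>n + 2 PD x\<close>. Almost rationality gives \<open>\<chi> u \<ge> 1\<close> for
  every effective \<open>u \<noteq> 0\<close> whose \<open>v\<^sub>0\<close>-coefficient is at most 1. Hence \<open>k(i)\<close> corresponds to
  the smallest \<open>x(i)\<close> with \<open>v\<^sub>0\<close>-coefficient \<open>i\<close> and \<open>x(i) \<cdot> v\<^sub>j \<le> 0\<close> for \<open>j \<noteq> 0\<close>, and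
  \<open>\<tau>(i) = \<chi>(x(i))\<close>. If a full path from an initial class uses the vertex \<open>v\<^sub>0\<close> exactly \<open>t\<close>
  times and ends at the class of \<open>x\<close>, then, by induction along the path,
  \<open>\<chi>(x - u) \<ge> \<chi>(x)\<close> for effective \<open>u\<close> with \<open>v\<^sub>0\<close>-coefficient at most \<open>t\<close>, with strict
  inequality if the coefficient is \<open>t + 1\<close>. For \<open>u = x - x(i)\<close>, where \<open>i\<close> is the
  \<open>v\<^sub>0\<close>-coefficient of \<open>x\<close>, this forces \<open>x = x(i)\<close>; for \<open>u = x(i) - x(s)\<close> it shows that \<open>\<tau>\<close>
  rises to the left of \<open>i\<close> before it can fall. Since \<open>\<tau>(i + 1) > \<tau>(i)\<close>, the vertex is a leaf.
\<close>

section \<open>The intersection form\<close>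

lemma int_form_add_left: "int_form adj e (x + y) z = int_form adj e x z + int_form adj e y z"
  by (simp add: int_form_def algebra_simps sum.distrib)

lemma int_form_add_right: "int_form adj e z (x + y) = int_form adj e z x + int_form adj e z y"
  by (simp add: int_form_def algebra_simps sum.distrib)

lemma int_form_diff_left: "int_form adj e (x - y) z = int_form adj e x z - int_form adj e y z"
  using int_form_add_left[of adj e "x - y" y z] by simp

lemma int_form_diff_right: "int_form adj e z (x - y) = int_form adj e z x - int_form adj e z y"
  using int_form_add_right[of adj e z "x - y" y] by simp

lemma int_form_zero_left [simp]: "int_form adj e 0 y = 0"
  by (simp add: int_form_def)

lemma int_form_vtx_right: "int_form adj e x (vtx j) = (\<Sum>i\<in>UNIV. x $ i * int_matrix adj e $ i $ j)"
  by (simp add: int_form_def axis_def if_distrib cong: if_cong)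

lemma int_form_vtx_vtx [simp]: "int_form adj e (vtx j) (vtx j) = e j"
proof -
  have "int_form adj e (vtx j) (vtx j) =
      (\<Sum>i\<in>UNIV. if i = j then int_matrix adj e $ i $ j else 0)"
    unfolding int_form_vtx_right by (rule sum.cong) (auto simp: axis_def)
  then show ?thesis
    by (simp add: int_matrix_def)
qed

lemma int_form_expand: "int_form adj e x y = (\<Sum>j\<in>UNIV. y $ j * int_form adj e x (vtx j))"
  unfolding int_form_vtx_right unfolding int_form_def
  by (subst sum.swap) (simp add: sum_distrib_left mult_ac)

lemma int_form_commute:
  assumes "simple_graph adj"
  shows "int_form adj e x y = int_form adj e y x"
proof -
  have "int_matrix adj e $ i $ j = int_matrix adj e $ j $ i" for i j
    using assms by (auto simp: int_matrix_def simple_graph_def)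
  then show ?thesis
    unfolding int_form_def by (subst sum.swap) (simp add: mult_ac)
qed

text \<open>Disjoint supports keep the diagonal weights out of the sum, and all other matrix entries
  are 0 or 1.\<close>

lemma int_form_nonneg:
  assumes "\<And>j. 0 \<le> x $ j" "\<And>j. 0 \<le> y $ j" "\<And>j. x $ j = 0 \<or> y $ j = 0"
  shows "0 \<le> int_form adj e x y"
proof -
  have "0 \<le> x $ i * int_matrix adj e $ i $ j * y $ j" for i j
    using assms(1)[of i] assms(2)[of j] assms(3)[of i] by (auto simp: int_matrix_def)
  then show ?thesis
    unfolding int_form_def by (intro sum_nonneg)
qed

lemma int_form_upd:
  "int_form adj (e(v := n)) x y = int_form adj e x y + (n - e v) * (x $ v * y $ v)"
proof -
  have m: "int_matrix adj (e(v := n)) $ i $ j =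
      int_matrix adj e $ i $ j + (if i = v then (if j = v then n - e v else 0) else 0)" for i j
    by (auto simp: int_matrix_def)
  have "int_form adj (e(v := n)) x y = int_form adj e x y +
      (\<Sum>i\<in>UNIV. \<Sum>j\<in>UNIV. if i = v then (if j = v then x $ i * (n - e v) * y $ j else 0) else 0)"
    unfolding int_form_def sum.distrib[symmetric] m
    by (intro sum.cong refl) (simp add: algebra_simps)
  also have "(\<Sum>i\<in>UNIV. \<Sum>j\<in>UNIV. if i = v then (if j = v then x $ i * (n - e v) * y $ j else 0) else 0)
      = (\<Sum>i\<in>UNIV. if i = v then x $ i * (n - e v) * y $ v else 0)"
    by (intro sum.cong refl) simp
  also have "\<dots> = (n - e v) * (x $ v * y $ v)"
    by simp
  finally show ?thesis .
qed

text \<open>Split \<open>x = p - q\<close> into positive and negative parts. Pairing with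
  \<open>q\<close> sees only vertices where \<open>x\<close> is negative, so x \<cdot> q \<le> 0,
  while p \<cdot> q \<ge> 0. Thus q \<cdot> q \<ge> 0, and definiteness gives
  \<open>q = 0\<close>.\<close>

lemma nonneg_if_int_form_vtx_nonpos:
  assumes "negative_definite adj e"
    and nonpos: "\<And>j. x $ j < 0 \<Longrightarrow> int_form adj e x (vtx j) \<le> 0"
  shows "0 \<le> x $ j"
proof -
  define p where "p = (\<chi> j. max 0 (x $ j))"
  define q where "q = (\<chi> j. max 0 (- x $ j))"
  have x: "x = p - q"
    by (auto simp: p_def q_def vec_eq_iff max_def)
  have "q $ j * int_form adj e x (vtx j) \<le> 0" for j
    using nonpos[of j] by (cases "x $ j < 0") (auto simp: q_def max_def intro: mult_nonpos_nonpos)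
  then have "int_form adj e x q \<le> 0"
    unfolding int_form_expand[of adj e x q] by (intro sum_nonpos)
  moreover have "0 \<le> int_form adj e p q"
    by (rule int_form_nonneg) (auto simp: p_def q_def)
  ultimately have "0 \<le> int_form adj e q q"
    unfolding x int_form_diff_left by linarith
  then have "q = 0"
    using assms(1) by (force simp: negative_definite_def)
  then have "q $ j = 0"
    by simp
  then show ?thesis
    by (simp add: q_def)
qed

section \<open>Characteristic classes\<close>

lemma additive_expand:
  assumes "Modules.additive k"
  shows "k x = (\<Sum>j\<in>UNIV. x $ j * k (vtx j))"
proof -
  interpret Modules.additive k by fact
  have axis: "k (axis j (int n)) = int n * k (vtx j)" for j n
  proof (induction n)
    case 0
    then show ?case using zero by (simp add: axis_eq_0_iff[THEN iffD2])
  next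
    case (Suc n)
    have "axis j (int (Suc n)) = axis j (int n) + vtx j"
      by (auto simp: axis_def vec_eq_iff)
    then show ?case
      using Suc add by (simp add: algebra_simps)
  qed
  have axis': "k (axis j n) = n * k (vtx j)" for j n
  proof (cases "0 \<le> n")
    case True
    then show ?thesis using axis[of j "nat n"] by simp
  next
    case False
    have "k (axis j n) = k (- axis j (int (nat (- n))))"
      using False by (intro arg_cong[of _ _ k]) (auto simp: axis_def vec_eq_iff)
    then show ?thesis using axis[of j "nat (- n)"] False unfolding minus by simp
  qed
  have "x = (\<Sum>j\<in>UNIV. axis j (x $ j))"
    by (simp add: vec_eq_iff axis_def)
  then have "k x = k (\<Sum>j\<in>UNIV. axis j (x $ j))"
    by (rule arg_cong)
  also have "\<dots> = (\<Sum>j\<in>UNIV. k (axis j (x $ j)))"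
    by (rule sum)
  also have "\<dots> = (\<Sum>j\<in>UNIV. x $ j * k (vtx j))"
    by (rule sum.cong[OF refl axis'])
  finally show ?thesis .
qed

lemma k_can_add: "k_can e (x + y) = k_can e x + k_can e y"
  by (simp add: k_can_def distrib_right sum.distrib)

lemma k_can_diff: "k_can e (x - y) = k_can e x - k_can e y"
  using k_can_add[of e "x - y" y] by simp

lemma k_can_zero [simp]: "k_can e 0 = 0"
  by (simp add: k_can_def)

lemma k_can_vtx [simp]: "k_can e (vtx j) = - e j - 2"
proof -
  have "k_can e (vtx j) = (\<Sum>i\<in>UNIV. if i = j then - e i - 2 else 0)"
    unfolding k_can_def by (rule sum.cong) (auto simp: axis_def)
  then show ?thesis
    by simp
qed

lemma k_can_upd: "k_can (e(v := n)) x = k_can e x - (n - e v) * x $ v"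
proof -
  have "k_can (e(v := n)) x = k_can e x + (\<Sum>i\<in>UNIV. if i = v then - (n - e v) * x $ v else 0)"
    unfolding k_can_def sum.distrib[symmetric] by (rule sum.cong) (auto simp: algebra_simps)
  then show ?thesis
    by (simp add: algebra_simps)
qed

definition cls :: "('v::finite \<Rightarrow> 'v \<Rightarrow> bool) \<Rightarrow> ('v \<Rightarrow> int) \<Rightarrow> int ^ 'v \<Rightarrow> (int ^ 'v \<Rightarrow> int)" where
  "cls adj e x = (\<lambda>y. k_can e y + 2 * int_form adj e x y)"

lemma add_2PD_cls: "add_2PD adj e v (cls adj e x) = cls adj e (x + vtx v)"
  by (auto simp: add_2PD_def cls_def PD_def int_form_add_left)

lemma cls_vtx: "cls adj e x (vtx j) = - e j - 2 + 2 * int_form adj e x (vtx j)"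
  by (simp add: cls_def)

lemma add_2PD_Char_classes:
  assumes "k \<in> Char_classes e"
  shows "add_2PD adj e j k \<in> Char_classes e"
  using assms
  by (auto simp: Char_classes_def dual_lattice_def Modules.additive_def add_2PD_def PD_def
      int_form_add_right cong_def algebra_simps)

text \<open>On vertices \<open>k\<close> and \<open>k_can e\<close> both have the parity of the
  weights, so half their difference is again an integral functional, and unimodularity represents it
  by a lattice point.\<close>

lemma Char_classes_obtain_cls:
  assumes "unimodular adj e" and "k \<in> Char_classes e"
  obtains x where "k = cls adj e x"
proof -
  have k: "Modules.additive k" and cong: "\<And>j. [k (vtx j) = e j] (mod 2)"
    using assms(2) by (auto simp: Char_classes_def dual_lattice_def)
  have "even (k (vtx j) + e j)" for j
    using cong[of j] by (simp add: cong_def) presburger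
  then have "2 dvd (\<Sum>j\<in>UNIV. y $ j * (k (vtx j) + e j + 2))" for y :: "int ^ 'a"
    by (intro dvd_sum dvd_mult) simp
  moreover have "k y - k_can e y = (\<Sum>j\<in>UNIV. y $ j * (k (vtx j) + e j + 2))" for y
    unfolding additive_expand[OF k, of y] k_can_def sum_subtractf[symmetric]
    by (rule sum.cong) (auto simp: algebra_simps)
  ultimately have even: "2 dvd k y - k_can e y" for y
    by simp
  define f where "f y = (k y - k_can e y) div 2" for y
  have f: "k y = k_can e y + 2 * f y" for y
    using even[of y] by (simp add: f_def)
  have "f \<in> dual_lattice"
    unfolding dual_lattice_def
  proof (intro CollectI Modules.additive.intro)
    fix x y
    have "k (x + y) = k x + k y"
      using k by (rule Modules.additive.add)
    then show "f (x + y) = f x + f y"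
      using f[of "x + y"] f[of x] f[of y] k_can_add[of e x y] by linarith
  qed
  then obtain x where "f = PD adj e x"
    using assms(1) by (auto simp: unimodular_def bij_betw_def)
  then have "k = cls adj e x"
    by (auto simp: f cls_def PD_def)
  then show ?thesis
    by (rule that)
qed

text \<open>\<open>dchi\<close> is \<open>2 \<chi>\<close> for the canonical class; doubling avoids the integer division.\<close>

definition dchi :: "('v::finite \<Rightarrow> 'v \<Rightarrow> bool) \<Rightarrow> ('v \<Rightarrow> int) \<Rightarrow> int ^ 'v \<Rightarrow> int" where
  "dchi adj e x = - (k_can e x + int_form adj e x x)"

lemma dchi_vtx [simp]: "dchi adj e (vtx j) = 2"
  by (simp add: dchi_def)

lemma dchi_add:
  assumes "simple_graph adj"
  shows "dchi adj e (x + y) = dchi adj e x + dchi adj e y - 2 * int_form adj e x y"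
  using int_form_commute[OF assms, of e x y]
  by (simp add: dchi_def int_form_add_left int_form_add_right k_can_add)

text \<open>By \<open>cls_vtx\<close>, the class of \<open>x\<close> takes the value
  \<open>- e j\<close> on a vertex exactly when \<open>x\<close> pairs to 1 with it; adding that
  vertex then leaves \<open>dchi\<close> unchanged.\<close>

lemma dchi_add_vtx:
  assumes "simple_graph adj"
  shows "dchi adj e (x + vtx j) = dchi adj e x + 2 - 2 * int_form adj e x (vtx j)"
  by (simp add: dchi_add[OF assms])

lemma dchi_diff:
  assumes "simple_graph adj"
  shows "dchi adj e (x - u) = dchi adj e x + cls adj e x u - int_form adj e u u"
  using int_form_commute[OF assms, of e x u]
  by (simp add: dchi_def cls_def int_form_diff_left int_form_diff_right k_can_diff)

text \<open>Changing the weight of \<open>v0\<close> by d changes \<open>k_can e u\<close> by -d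
  times the \<open>v0\<close>-coefficient of \<open>u\<close>, and u \<cdot> u by d times its
  square. These cancel when the coefficient is 0 or 1, so the bound passes from the rational graph
  to the original weights.\<close>

lemma almost_rational_dchi_ge_2:
  assumes "almost_rational_at adj e v0"
    and "\<And>j. 0 \<le> u $ j" "u \<noteq> 0" "u $ v0 \<le> 1"
  shows "2 \<le> dchi adj e u"
proof -
  obtain n where n: "rational_graph adj (e(v0 := n))"
    using assms(1) by (auto simp: almost_rational_at_def)
  have "u $ v0 * u $ v0 = u $ v0"
    using assms(2)[of v0] assms(4) by (cases "u $ v0 = 0") auto
  then have "k_can (e(v0 := n)) u + int_form adj (e(v0 := n)) u u = - dchi adj e u"
    by (simp add: k_can_upd int_form_upd dchi_def)
  then have "chi_fun adj (e(v0 := n)) (k_can (e(v0 := n))) u = dchi adj e u div 2"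
    by (simp add: chi_fun_def)
  moreover have "1 \<le> chi_fun adj (e(v0 := n)) (k_can (e(v0 := n))) u"
    using n assms(2,3) by (auto simp: rational_graph_def)
  ultimately show ?thesis
    by linarith
qed

section \<open>Full paths\<close>

text \<open>
  For \<open>k\<close> the class of \<open>x\<close> the inequality \<open>u \<cdot> u \<le> k u\<close> says that \<open>\<chi>(x - u) \<ge> \<chi>(x)\<close>.
\<close>
definition path_bound ::
  "('v::finite \<Rightarrow> 'v \<Rightarrow> bool) \<Rightarrow> ('v \<Rightarrow> int) \<Rightarrow> 'v \<Rightarrow> nat \<Rightarrow> (int ^ 'v \<Rightarrow> int) \<Rightarrow> bool" where
  "path_bound adj e v0 t k \<longleftrightarrow>
     (\<forall>u. (\<forall>j. 0 \<le> u $ j) \<longrightarrow>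
       (u $ v0 \<le> int t \<longrightarrow> int_form adj e u u \<le> k u) \<and>
       (u $ v0 = int t + 1 \<longrightarrow> int_form adj e u u < k u))"

text \<open>The lower bounds on an initial class give \<open>k u\<close> \<ge>
  \<open>- k_can e u\<close> for effective \<open>u\<close>, so \<open>k u\<close> exceeds u \<cdot>
  u by at least \<open>dchi adj e u\<close>. Almost rationality controls the coefficients 0 and 1,
  which is the range of both clauses at \<open>t = 0\<close>.\<close>

lemma initial_class_path_bound:
  assumes "almost_rational_at adj e v0" and "initial_class e k"
  shows "path_bound adj e v0 0 k"
  unfolding path_bound_def
proof (intro allI impI)
  fix u :: "int ^ 'a"
  assume u: "\<forall>j. 0 \<le> u $ j"
  have "Modules.additive k"
    using assms(2) by (auto simp: initial_class_def Char_classes_def dual_lattice_def)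
  then have "k u = (\<Sum>j\<in>UNIV. u $ j * k (vtx j))"
    by (rule additive_expand)
  also have "\<dots> \<ge> (\<Sum>j\<in>UNIV. u $ j * (e j + 2))"
    using assms(2) u by (intro sum_mono mult_left_mono) (auto simp: initial_class_def)
  also have "(\<Sum>j\<in>UNIV. u $ j * (e j + 2)) = - k_can e u"
    by (simp add: k_can_def sum_negf[symmetric] algebra_simps)
  finally have "dchi adj e u + int_form adj e u u \<le> k u"
    by (simp add: dchi_def)
  moreover have "2 \<le> dchi adj e u" if "u \<noteq> 0" "u $ v0 \<le> 1"
    using almost_rational_dchi_ge_2[OF assms(1)] u that by blast
  moreover have "dchi adj e 0 = 0"
    by (simp add: dchi_def)
  ultimately show "(u $ v0 \<le> int 0 \<longrightarrow> int_form adj e u u \<le> k u) \<and>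
      (u $ v0 = int 0 + 1 \<longrightarrow> int_form adj e u u < k u)"
    by (cases "u = 0") auto
qed

text \<open>If \<open>u\<close> contains the vertex \<open>j\<close>, the excess of the new class at
  \<open>u\<close> equals the excess of \<open>k\<close> at \<open>w = u - vtx j\<close>, because
  \<open>k (vtx j) = - e j\<close>. For \<open>j = v0\<close> the coefficient drops by one, which
  lets \<open>t\<close> grow by one. If \<open>u\<close> misses \<open>j\<close>, the excess does
  not decrease.\<close>

lemma path_bound_add_2PD:
  assumes "simple_graph adj" and "Modules.additive k"
    and "k (vtx j) = - e j" and bound: "path_bound adj e v0 t k"
  shows "path_bound adj e v0 (if j = v0 then Suc t else t) (add_2PD adj e j k)"
  unfolding path_bound_def
proof (intro allI impI)
  fix u :: "int ^ 'a"
  assume u: "\<forall>j. 0 \<le> u $ j"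
  let ?t = "if j = v0 then Suc t else t"
  show "(u $ v0 \<le> int ?t \<longrightarrow> int_form adj e u u \<le> add_2PD adj e j k u) \<and>
      (u $ v0 = int ?t + 1 \<longrightarrow> int_form adj e u u < add_2PD adj e j k u)"
  proof (cases "u $ j = 0")
    case True
    have "0 \<le> int_form adj e (vtx j) u"
      by (rule int_form_nonneg) (use u True in \<open>auto simp: axis_def\<close>)
    then have "k u \<le> add_2PD adj e j k u"
      by (simp add: add_2PD_def PD_def)
    \<comment> \<open>For \<open>j = v0\<close> the \<open>v0\<close>-coefficient of
      \<open>u\<close> is 0, so only the weak inequality is asked for.\<close>
    then show ?thesis
      using bound u True unfolding path_bound_def by (cases "j = v0") fastforce+
  next
    case False
    define w where "w = u - vtx j"
    have u_eq: "u = w + vtx j"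
      by (simp add: w_def)
    have "0 \<le> w $ i" for i
      using u[rule_format, of i] False by (auto simp: w_def axis_def)
    moreover have "w $ v0 = (if j = v0 then u $ v0 - 1 else u $ v0)"
      by (simp add: w_def axis_def)
    moreover have "add_2PD adj e j k u - int_form adj e u u = k w - int_form adj e w w"
      using int_form_commute[OF assms(1), of e "vtx j" w]
      by (simp add: u_eq add_2PD_def PD_def int_form_add_left int_form_add_right
          Modules.additive.add[OF assms(2)] assms(3))
    ultimately show ?thesis
      using bound[unfolded path_bound_def, rule_format, of w] by (auto split: if_splits)
  qed
qed

lemma full_path_last:
  assumes "simple_graph adj" and "almost_rational_at adj e v0" and "full_path adj e ks"
  obtains t where "last ks \<in> Char_classes e" "path_bound adj e v0 t (last ks)"
proof -
  have "\<exists>t. last ks \<in> Char_classes e \<and> path_bound adj e v0 t (last ks)"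
    if "ks \<noteq> []" "successively (full_path_step adj e) ks"
      "hd ks \<in> Char_classes e" "path_bound adj e v0 t (hd ks)" for t
    using that
  proof (induction ks arbitrary: t rule: induct_list012)
    case (3 k k' ks)
    then obtain j where j: "k (vtx j) = - e j" "k' = add_2PD adj e j k"
      by (auto simp: full_path_step_def)
    have "k \<in> Char_classes e" "path_bound adj e v0 t k"
      using 3 by auto
    then have "k' \<in> Char_classes e" "path_bound adj e v0 (if j = v0 then Suc t else t) k'"
      using path_bound_add_2PD[of adj k j e v0 t] assms(1) j(1) add_2PD_Char_classes
      by (auto simp: j(2) Char_classes_def dual_lattice_def)
    then show ?case
      using 3 by auto
  qed auto
  then show ?thesis
    using assms(3) initial_class_path_bound[OF assms(2)] that
    by (auto simp: full_path_def initial_class_def)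
qed

section \<open>Laufer sequences\<close>

text \<open>Write the current class as that of \<open>x + w\<close>. The run preserves
  \<open>dchi adj e w\<close> \<le> 2; at its end, almost rationality applied to
  \<open>w + vtx j\<close> bounds the pairing of \<open>w\<close> with \<open>vtx j\<close> by 1. So
  \<open>x + w\<close> pairs to at most 1 with \<open>vtx j\<close>, and stopping excludes
  1.\<close>

lemma laufer_steps:
  assumes "simple_graph adj" and "almost_rational_at adj e v0"
    and x: "\<And>j. j \<noteq> v0 \<Longrightarrow> int_form adj e x (vtx j) \<le> 0"
    and steps: "(laufer_step adj e v0)\<^sup>*\<^sup>* (add_2PD adj e v0 (cls adj e x)) k'"
    and stop: "\<nexists>j. j \<noteq> v0 \<and> k' (vtx j) = - e j"
  obtains y where "k' = cls adj e y" "y $ v0 = x $ v0 + 1" "\<And>j. x $ j \<le> y $ j"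
    "\<And>j. j \<noteq> v0 \<Longrightarrow> int_form adj e y (vtx j) \<le> 0"
    "dchi adj e y = dchi adj e (x + vtx v0)"
    "\<And>z j. z $ v0 = x $ v0 + 1 \<Longrightarrow> (\<And>j. j \<noteq> v0 \<Longrightarrow> int_form adj e z (vtx j) \<le> 0) \<Longrightarrow>
      (\<And>j. (x + vtx v0) $ j \<le> z $ j) \<Longrightarrow> y $ j \<le> z $ j"
proof -
  define le where "le z z' \<longleftrightarrow> (\<forall>j. z $ j \<le> z' $ j)" for z z' :: "int ^ 'a"
  define upper where "upper z \<longleftrightarrow> z $ v0 = x $ v0 + 1 \<and>
    (\<forall>j. j \<noteq> v0 \<longrightarrow> int_form adj e z (vtx j) \<le> 0) \<and> le (x + vtx v0) z" for z
  have "\<exists>w. k' = cls adj e (x + w) \<and> le 0 w \<and> w $ v0 = 1 \<and> dchi adj e w \<le> 2 \<and>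
      dchi adj e (x + w) = dchi adj e (x + vtx v0) \<and> (\<forall>z. upper z \<longrightarrow> le (x + w) z)"
    using steps
  proof (induction rule: rtranclp_induct)
    case base
    show ?case
    proof (intro exI[of _ "vtx v0"] conjI)
      show "le 0 (vtx v0)"
        by (simp add: le_def axis_def)
    qed (simp_all add: add_2PD_cls upper_def)
  next
    case (step k k')
    then obtain w where w: "k = cls adj e (x + w)" "le 0 w" "w $ v0 = 1" "dchi adj e w \<le> 2"
      "dchi adj e (x + w) = dchi adj e (x + vtx v0)" "\<And>z. upper z \<Longrightarrow> le (x + w) z"
      by auto
    from step(2) obtain j where j: "j \<noteq> v0" "k (vtx j) = - e j" "k' = add_2PD adj e j k"
      by (auto simp: laufer_step_def)
    have one: "int_form adj e (x + w) (vtx j) = 1"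
      using j(2) unfolding w(1) cls_vtx by simp
    have "le (x + (w + vtx j)) z" if z: "upper z" for z
      unfolding le_def
    proof
      fix i
      have xz: "(x + w) $ i \<le> z $ i" for i
        using w(6)[OF z] by (simp add: le_def)
      \<comment> \<open>If they agreed at \<open>j\<close>, the effective difference
        \<open>z - (x + w)\<close> would pair nonnegatively with \<open>vtx j\<close>, so
        \<open>z\<close> would pair to at least 1.\<close>
      have "(x + w) $ j \<noteq> z $ j"
      proof
        assume eq: "(x + w) $ j = z $ j"
        have "0 \<le> int_form adj e (z - (x + w)) (vtx j)"
          by (rule int_form_nonneg) (use xz eq in \<open>auto simp: axis_def\<close>)
        then show False
          using one z j(1) by (auto simp: upper_def int_form_diff_left)
      qed
      then show "(x + (w + vtx j)) $ i \<le> z $ i"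
        using xz[of i] by (auto simp: axis_def)
    qed
    \<comment> \<open>Since \<open>x\<close> pairs nonpositively with \<open>vtx j\<close>,
      \<open>w\<close> pairs to at least 1, so \<open>dchi\<close> cannot grow.\<close>
    moreover have "dchi adj e (w + vtx j) \<le> 2"
      using one x[OF j(1)] w(4) by (simp add: dchi_add_vtx[OF assms(1)] int_form_add_left)
    moreover have "dchi adj e (x + (w + vtx j)) = dchi adj e (x + w)"
      using dchi_add_vtx[OF assms(1), of e "x + w" j] one by (simp add: add.assoc)
    ultimately show ?case
      using w(2,3,5) j(1)
      by (intro exI[of _ "w + vtx j"]) (auto simp: j(3) w(1) add_2PD_cls add.assoc le_def axis_def)
  qed
  then obtain w where w: "k' = cls adj e (x + w)" "\<And>j. 0 \<le> w $ j" "w $ v0 = 1"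
      "dchi adj e w \<le> 2" "dchi adj e (x + w) = dchi adj e (x + vtx v0)"
      "\<And>z j. upper z \<Longrightarrow> (x + w) $ j \<le> z $ j"
    by (auto simp: le_def)
  show ?thesis
  proof (rule that[of "x + w"])
    fix j
    assume j: "j \<noteq> v0"
    have "(w + vtx j) $ v0 = 1"
      using j w(3) by (simp add: axis_def)
    moreover have "0 \<le> (w + vtx j) $ i" for i
      using w(2)[of i] by (simp add: axis_def)
    moreover have "w + vtx j \<noteq> 0"
      using calculation(1) by (metis zero_index zero_neq_one)
    ultimately have "2 \<le> dchi adj e (w + vtx j)"
      by (intro almost_rational_dchi_ge_2[OF assms(2)]) auto
    then have "int_form adj e w (vtx j) \<le> 1"
      using w(4) by (simp add: dchi_add_vtx[OF assms(1)])
    then have "int_form adj e (x + w) (vtx j) \<le> 1"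
      using x[OF j] by (simp add: int_form_add_left)
    moreover have "int_form adj e (x + w) (vtx j) \<noteq> 1"
      using stop j unfolding w(1) cls_vtx by auto
    ultimately show "int_form adj e (x + w) (vtx j) \<le> 0"
      by simp
  qed (use w in \<open>auto simp: upper_def le_def\<close>)
qed

text \<open>\<open>laufer_steps\<close> gives minimality only among points above
  \<open>X i + vtx v0\<close>. Induction on \<open>i\<close> removes this restriction: for a
  candidate \<open>z\<close> at stage \<open>i + 1\<close>, \<open>z - vtx v0\<close> is a candidate
  at stage \<open>i\<close>.\<close>

lemma laufer_sequence_cls:
  assumes "simple_graph adj" and "negative_definite adj e"
    and "almost_rational_at adj e v0" and "laufer_sequence adj e v0 k"
  obtains X where
    "\<And>i. k i = cls adj e (X i)" "\<And>i. X i $ v0 = int i"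
    "\<And>i j. j \<noteq> v0 \<Longrightarrow> int_form adj e (X i) (vtx j) \<le> 0"
    "\<And>s i j. s \<le> i \<Longrightarrow> X s $ j \<le> X i $ j"
    "\<And>i. 2 * tau_fun adj e v0 k i = dchi adj e (X i)"
    "\<And>i z j. z $ v0 = int i \<Longrightarrow> (\<And>j. j \<noteq> v0 \<Longrightarrow> int_form adj e z (vtx j) \<le> 0) \<Longrightarrow>
      X i $ j \<le> z $ j"
proof -
  have k0: "k 0 = cls adj e 0"
    using assms(4) by (auto simp: laufer_sequence_def cls_def)
  \<comment> \<open>The last conjunct pins the start to 0, the base case for both the
    \<open>tau_fun\<close> formula and minimality.\<close>
  define P where "P i x \<longleftrightarrow> k i = cls adj e x \<and> x $ v0 = int i \<and>
    (\<forall>j. j \<noteq> v0 \<longrightarrow> int_form adj e x (vtx j) \<le> 0) \<and> (i = 0 \<longrightarrow> x = 0)" for i x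
  define Q where "Q x y \<longleftrightarrow> (\<forall>j. x $ j \<le> y $ j) \<and> dchi adj e y = dchi adj e (x + vtx v0) \<and>
    (\<forall>z j. z $ v0 = x $ v0 + 1 \<longrightarrow> (\<forall>j. j \<noteq> v0 \<longrightarrow> int_form adj e z (vtx j) \<le> 0) \<longrightarrow>
      (\<forall>j. (x + vtx v0) $ j \<le> z $ j) \<longrightarrow> y $ j \<le> z $ j)" for x y
  have "\<exists>X. \<forall>i. P i (X i) \<and> Q (X i) (X (Suc i))"
  \<comment> \<open>Dependent choice keeps the relation \<open>Q\<close> between consecutive
    points.\<close>
  proof (rule dependent_nat_choice)
    show "\<exists>x. P 0 x"
      using k0 by (auto simp: P_def)
  next
    fix x i
    assume P: "P i x"
    have "k i = cls adj e x"
      using P by (simp add: P_def)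
    then have steps: "(laufer_step adj e v0)\<^sup>*\<^sup>* (add_2PD adj e v0 (cls adj e x)) (k (Suc i))"
      and stop: "\<nexists>j. j \<noteq> v0 \<and> k (Suc i) (vtx j) = - e j"
      using assms(4) unfolding laufer_sequence_def by metis+
    have "int_form adj e x (vtx j) \<le> 0" if "j \<noteq> v0" for j
      using P that by (simp add: P_def)
    from laufer_steps[OF assms(1,3) this steps stop] obtain y where
      "k (Suc i) = cls adj e y" "y $ v0 = x $ v0 + 1" "\<And>j. x $ j \<le> y $ j"
      "\<And>j. j \<noteq> v0 \<Longrightarrow> int_form adj e y (vtx j) \<le> 0"
      "dchi adj e y = dchi adj e (x + vtx v0)"
      "\<And>z j. z $ v0 = x $ v0 + 1 \<Longrightarrow> (\<And>j. j \<noteq> v0 \<Longrightarrow> int_form adj e z (vtx j) \<le> 0) \<Longrightarrow>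
        (\<And>j. (x + vtx v0) $ j \<le> z $ j) \<Longrightarrow> y $ j \<le> z $ j"
      by blast
    then show "\<exists>y. P (Suc i) y \<and> Q x y"
      using P by (intro exI[of _ y]) (auto simp: P_def Q_def)
  qed
  then obtain X where P: "\<And>i. P i (X i)" and Q: "\<And>i. Q (X i) (X (Suc i))"
    by blast
  show ?thesis
  proof (rule that[of X])
    show "X s $ j \<le> X i $ j" if "s \<le> i" for s i j
      using that by (rule lift_Suc_mono_le[rotated]) (use Q in \<open>simp add: Q_def\<close>)
  next
    fix i
    show "2 * tau_fun adj e v0 k i = dchi adj e (X i)"
    proof (induction i)
      case 0
      then show ?case
        using P[of 0] by (simp add: tau_fun_def P_def dchi_def)
    next
      case (Suc i)
      have "k i (vtx v0) = - e v0 - 2 + 2 * int_form adj e (X i) (vtx v0)"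
        using P[of i] by (simp add: P_def cls_vtx)
      then have "chi_fun adj e (k i) (vtx v0) = 1 - int_form adj e (X i) (vtx v0)"
        by (simp add: chi_fun_def)
      then show ?case
        using Suc Q[of i] by (simp add: tau_fun_def Q_def dchi_add_vtx[OF assms(1)])
    qed
  next
    fix i z j
    assume "z $ v0 = int i" "\<And>j. j \<noteq> v0 \<Longrightarrow> int_form adj e z (vtx j) \<le> 0"
    then show "X i $ j \<le> z $ j"
    proof (induction i arbitrary: z j)
      case 0
      have "0 \<le> z $ j"
        \<comment> \<open>The \<open>v0\<close>-coefficient is 0, so negative coefficients could
          occur only at other vertices, where the pairing is nonpositive.\<close>
        by (rule nonneg_if_int_form_vtx_nonpos[OF assms(2)]) (use 0 in force)
      then show ?case
        using P[of 0] by (simp add: P_def)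
    next
      case (Suc i)
      have le: "X i $ l \<le> (z - vtx v0) $ l" for l
      proof (rule Suc.IH)
        show "(z - vtx v0) $ v0 = int i"
          using Suc.prems by (simp add: axis_def)
      next
        fix l
        assume l: "l \<noteq> v0"
        have "0 \<le> int_form adj e (vtx v0) (vtx l)"
          by (rule int_form_nonneg) (use l in \<open>auto simp: axis_def\<close>)
        then show "int_form adj e (z - vtx v0) (vtx l) \<le> 0"
          using Suc.prems(2)[OF l] by (simp add: int_form_diff_left)
      qed
      have "(X i + vtx v0) $ l \<le> z $ l" for l
        using le[of l] by simp
      moreover have "z $ v0 = X i $ v0 + 1"
        using Suc.prems P[of i] by (simp add: P_def)
      ultimately show ?case
        using Q[of i] Suc.prems(2) unfolding Q_def by blast
    qed
  qed (use P in \<open>auto simp: P_def\<close>)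
qed

section \<open>Leaves of graded roots\<close>

lemma gr_rel_refl: "(p, p) \<in> gr_rel \<tau>"
  by (simp add: gr_rel_def)

lemma sym_gr_rel: "sym (gr_rel \<tau>)"
  unfolding gr_rel_def by (intro sym_rtrancl) (auto simp: sym_def)

lemma trans_gr_rel: "trans (gr_rel \<tau>)"
  by (simp add: gr_rel_def trans_rtrancl)

lemma gr_class_eqI:
  assumes "((i, n), (j, m)) \<in> gr_rel \<tau>"
  shows "gr_class \<tau> j m = gr_class \<tau> i n"
  using assms sym_gr_rel[of \<tau>] trans_gr_rel[of \<tau>] unfolding gr_class_def sym_def trans_def
  by blast

text \<open>Glued paths stay glued at all higher levels, so the upward neighbour of a vertex of the
  graded root is well defined.\<close>

lemma gr_rel_shift:
  assumes "(p, q) \<in> gr_rel \<tau>"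
  shows "((fst p, snd p + 1), (fst q, snd q + 1)) \<in> gr_rel \<tau>"
  using assms unfolding gr_rel_def
proof (induction rule: rtrancl_induct)
  case (step y z)
  have "((fst y, snd y + 1), (fst z, snd z + 1)) \<in> gr_glue \<tau> \<union> (gr_glue \<tau>)\<inverse>"
    using step(2) by (fastforce simp: gr_glue_def)
  with step(3) show ?case
    by (rule rtrancl_into_rtrancl)
qed auto

text \<open>The class of \<open>(i, \<tau> i)\<close> contains only bottom points of paths, so its
  single edge goes up. Gluing cannot pass to the right of \<open>i\<close>, where the next path
  starts higher; to the left it meets no lower path within \<open>t\<close> steps and is blocked at
  step \<open>t + 1\<close>, or by the index 0.\<close>

lemma gr_leafI:
  assumes right: "\<tau> i < \<tau> (Suc i)"
    and left: "\<And>s. s \<le> i \<Longrightarrow> i - s \<le> t \<Longrightarrow> \<tau> i \<le> \<tau> s"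
    and left': "\<And>s. s + Suc t = i \<Longrightarrow> \<tau> i < \<tau> s"
  shows "gr_leaf \<tau> (gr_class \<tau> i (\<tau> i))"
proof -
  define n where "n = \<tau> i"
  define C where "C = gr_class \<tau> i n"
  have "snd p = n \<and> \<tau> (fst p) = n \<and> fst p \<le> i \<and> i - fst p \<le> t" if "((i, n), p) \<in> gr_rel \<tau>" for p
    using that unfolding gr_rel_def
  proof (induction rule: rtrancl_induct)
    case base
    then show ?case by (simp add: n_def)
  next
    case (step p q)
    obtain a where p: "p = (a, n)" and a: "\<tau> a = n" "a \<le> i" "i - a \<le> t"
      using step(3) by (cases p) auto
    from step(2) consider "q = (Suc a, n)" "\<tau> (Suc a) \<le> n"
      | b where "a = Suc b" "q = (b, n)" "\<tau> b \<le> n"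
      unfolding p by (auto simp: gr_glue_def)
    then show ?case
    proof cases
      case 1
      have "a \<noteq> i"
        using right 1(2) by (auto simp: n_def)
      then show ?thesis
        using 1 a left[of "Suc a"] by (auto simp: n_def)
    next
      case 2
      have "b + Suc t \<noteq> i"
        using left'[of b] 2(3) by (auto simp: n_def)
      then have "i - b \<le> t"
        using 2(1) a by auto
      then show ?thesis
        using 2 a left[of b] by (auto simp: n_def)
    qed
  qed
  then have C: "m = n \<and> \<tau> j = n" if "(j, m) \<in> C" for j m
    using that by (force simp: C_def gr_class_def)
  have "{d \<in> gr_edges \<tau>. C \<in> d} = {{C, gr_class \<tau> i (n + 1)}}"
  proof (intro equalityI subsetI)
    fix d
    assume "d \<in> {d \<in> gr_edges \<tau>. C \<in> d}"
    then obtain j m where d: "d = {gr_class \<tau> j m, gr_class \<tau> j (m + 1)}" "\<tau> j \<le> m" "C \<in> d"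
      by (auto simp: gr_edges_def)
    have self: "(j, l) \<in> gr_class \<tau> j l" for l
      by (simp add: gr_class_def gr_rel_refl)
    \<comment> \<open>The point \<open>(j, m + 1)\<close> lies strictly above the bottom of its
      path, whereas \<open>C\<close> has only bottom points.\<close>
    have "C \<noteq> gr_class \<tau> j (m + 1)"
      using C[of j "m + 1"] self[of "m + 1"] d(2) by auto
    then have eq: "C = gr_class \<tau> j m"
      using d(1,3) by auto
    then have in_C: "(j, m) \<in> C"
      using self by simp
    then have m: "m = n"
      using C by blast
    have "((i, n), (j, n)) \<in> gr_rel \<tau>"
      using in_C by (simp add: C_def gr_class_def m)
    from gr_rel_shift[OF this] have "gr_class \<tau> j (n + 1) = gr_class \<tau> i (n + 1)"
      by (intro gr_class_eqI) simp
    then show "d \<in> {{C, gr_class \<tau> i (n + 1)}}"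
      using d(1) eq m by simp
  next
    fix d
    assume "d \<in> {{C, gr_class \<tau> i (n + 1)}}"
    then show "d \<in> {d \<in> gr_edges \<tau>. C \<in> d}"
      by (auto simp: gr_edges_def C_def n_def)
  qed
  then have "gr_valency \<tau> C = 1"
    by (simp add: gr_valency_def)
  moreover have "C \<in> gr_vertices \<tau>"
    unfolding gr_vertices_def C_def gr_class_def
    by (rule quotientI) (simp add: gr_points_def n_def)
  ultimately show ?thesis
    by (simp add: gr_leaf_def C_def n_def)
qed

theorem proposition2p3:
  fixes adj :: "'v::finite \<Rightarrow> 'v \<Rightarrow> bool"
    and e :: "'v \<Rightarrow> int"
    and v0 :: 'v
    and k :: "nat \<Rightarrow> (int ^ 'v \<Rightarrow> int)"
    and ks :: "(int ^ 'v \<Rightarrow> int) list"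
    and \<l> :: "int ^ 'v \<Rightarrow> int"
  assumes "is_tree adj"
    and "negative_definite adj e"
    and "unimodular adj e"
    and "almost_rational_at adj e v0"
    and "laufer_sequence adj e v0 k"
    and "good_full_path adj e ks"
    and "\<l> = last ks"
  shows "\<exists>i. \<l> = k i \<and>
           gr_leaf (tau_fun adj e v0 k)
             (gr_class (tau_fun adj e v0 k) i (tau_fun adj e v0 k i))"
proof -
  have simple: "simple_graph adj"
    using assms(1) by (simp add: is_tree_def)
  have path: "full_path adj e ks" and good: "good_terminal e \<l>"
    using assms(6,7) by (auto simp: good_full_path_def)
  obtain t where char: "\<l> \<in> Char_classes e" and bound: "path_bound adj e v0 t \<l>"
    using full_path_last[OF simple assms(4) path] assms(7) by blast
  obtain x where x: "\<l> = cls adj e x"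
    using Char_classes_obtain_cls[OF assms(3) char] .
  \<comment> \<open>For the class of \<open>x\<close>, the upper bound in
    \<open>good_terminal\<close> is exactly this inequality.\<close>
  have x_vtx: "int_form adj e x (vtx j) \<le> 0" for j
    using good cls_vtx[of adj e x j] unfolding good_terminal_def x by (smt (verit))
  have x_nonneg: "0 \<le> x $ j" for j
    by (rule nonneg_if_int_form_vtx_nonpos[OF assms(2) x_vtx])
  from laufer_sequence_cls[OF simple assms(2,4,5)] obtain X where
    X: "\<And>i. k i = cls adj e (X i)" and X_v0: "\<And>i. X i $ v0 = int i"
    and X_vtx: "\<And>i j. j \<noteq> v0 \<Longrightarrow> int_form adj e (X i) (vtx j) \<le> 0"
    and X_mono: "\<And>s i j. s \<le> i \<Longrightarrow> X s $ j \<le> X i $ j"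
    and tau: "\<And>i. 2 * tau_fun adj e v0 k i = dchi adj e (X i)"
    and X_min: "\<And>i z j. z $ v0 = int i \<Longrightarrow>
      (\<And>j. j \<noteq> v0 \<Longrightarrow> int_form adj e z (vtx j) \<le> 0) \<Longrightarrow> X i $ j \<le> z $ j"
    by blast
  define i where "i = nat (x $ v0)"
  have i: "x $ v0 = int i"
    using x_nonneg by (simp add: i_def)
  define u where "u = x - X i"
  have u_nonneg: "0 \<le> u $ j" for j
    using X_min[OF i x_vtx, of j] by (simp add: u_def)
  have u_v0: "u $ v0 = 0"
    by (simp add: u_def i X_v0)
  \<comment> \<open>The path bound at \<open>u\<close> gives \<open>dchi adj e u\<close> \<le> 2 (X
    i \<cdot> u). The right side is at most 0, since \<open>u\<close> misses \<open>v0\<close>, but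
    almost rationality makes the left side at least 2.\<close>
  have "u = 0"
  proof (rule ccontr)
    assume "u \<noteq> 0"
    then have "2 \<le> dchi adj e u"
      by (intro almost_rational_dchi_ge_2[OF assms(4) u_nonneg]) (simp_all add: u_v0)
    moreover have "int_form adj e (X i) u \<le> 0"
      unfolding int_form_expand[of adj e "X i" u]
    proof (rule sum_nonpos)
      fix j
      show "u $ j * int_form adj e (X i) (vtx j) \<le> 0"
        using X_vtx[of j i] u_nonneg[of j] u_v0
        by (cases "j = v0") (auto simp: mult_nonneg_nonpos)
    qed
    moreover have "int_form adj e u u \<le> \<l> u"
      using bound u_nonneg u_v0 by (simp add: path_bound_def)
    moreover have "\<l> u = k_can e u + 2 * int_form adj e (X i) u + 2 * int_form adj e u u"
      by (simp add: x cls_def u_def int_form_diff_left algebra_simps)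
    ultimately show False
      by (simp add: dchi_def)
  qed
  then have x_X: "x = X i"
    by (simp add: u_def)
  have diff: "dchi adj e (X s) = dchi adj e (X i) + (\<l> (X i - X s) - int_form adj e (X i - X s) (X i - X s))"
    for s
    using dchi_diff[OF simple, of e "X i" "X i - X s"] by (simp add: x x_X)
  \<comment> \<open>The \<open>v0\<close>-coefficient of \<open>X i - X s\<close> is
    \<open>i - s\<close>, so the \<open>t\<close> of the path bound serves as the distance in
    \<open>gr_leafI\<close>.\<close>
  have bound': "(int i - int s \<le> int t \<longrightarrow> int_form adj e (X i - X s) (X i - X s) \<le> \<l> (X i - X s)) \<and>
      (int i - int s = int t + 1 \<longrightarrow> int_form adj e (X i - X s) (X i - X s) < \<l> (X i - X s))"
    if "s \<le> i" for s
    using bound[unfolded path_bound_def, rule_format, of "X i - X s"] X_mono[OF that]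
    by (simp add: X_v0)
  have "gr_leaf (tau_fun adj e v0 k) (gr_class (tau_fun adj e v0 k) i (tau_fun adj e v0 k i))"
  proof (rule gr_leafI[of _ _ t])
    have "k i (vtx v0) = - e v0 - 2 + 2 * int_form adj e x (vtx v0)"
      by (simp add: X x_X cls_vtx)
    then have "chi_fun adj e (k i) (vtx v0) = 1 - int_form adj e x (vtx v0)"
      by (simp add: chi_fun_def)
    then show "tau_fun adj e v0 k i < tau_fun adj e v0 k (Suc i)"
      using x_vtx[of v0] by (simp add: tau_fun_def)
  next
    fix s
    assume "s \<le> i" "i - s \<le> t"
    then show "tau_fun adj e v0 k i \<le> tau_fun adj e v0 k s"
      using bound'[of s] diff[of s] tau[of s] tau[of i] by force
  next
    fix s
    assume "s + Suc t = i"
    then show "tau_fun adj e v0 k i < tau_fun adj e v0 k s"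
      using bound'[of s] diff[of s] tau[of s] tau[of i] by force
  qed
  moreover have "\<l> = k i"
    by (simp add: X x x_X)
  ultimately show ?thesis
    by blast
qed

end
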